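(* Let $d\ge 2$ and let $E$ be a POVM with finitely many outcomes on $\mathbb{C}^d\otimes\mathbb{C}^d$ which determines whether a state is separable or entangled, i.e., there do not exist a separable state $\varrho_1$ and an entangled state $\varrho_2$ on $\mathbb{C}^d\otimes\mathbb{C}^d$ with $\mathrm{tr}[\varrho_1E_j]=\mathrm{tr}[\varrho_2E_j]$ for all outcomes $j$. Then $E$ is informationally complete.
   Context: A state on $\mathbb{C}^d\otimes\mathbb{C}^d$ is a positive semidefinite operator of trace one. A POVM with finitely many outcomes is a finite family $(E_j)$ of positive semidefinite operators on $\mathbb{C}^d\otimes\mathbb{C}^d$ with $\sum_j E_j=\mathbb{1}$; measuring it in the state $\varrho$ gives outcome $j$ with probability $\mathrm{tr}[\varrho E_j]$. Put $\mathcal{X}_E=\{\Delta \text{ Hermitian} \mid \mathrm{tr}[\Delta E_j]=0 \text{ for all } j\}$ (such $\Delta$ are automatically traceless). $E$ is informationally complete if $\mathcal{X}_E=\{0\}$; equivalently, any two distinct states yield different outcome probabilities. A state is separable if it is a finite convex combination $\varrho=\sum_i c_i\,\sigma_i\otimes\eta_i$ ($c_i\ge 0$, $\sum_i c_i=1$) of product states, where $\sigma_i,\eta_i$ are states on $\mathbb{C}^d$; otherwise it is entangled. *)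

theory Defs
  imports "HOL-Analysis.Analysis"
begin

text \<open>
  Operators on \<open>\<complex>\<^sup>n\<close> are matrices of type \<open>complex^'n^'n\<close>. The space \<open>\<complex>\<^sup>d \<otimes> \<complex>\<^sup>d\<close> is
  \<open>complex^('d \<times> 'd)\<close> with the product basis indexed by pairs, so tensor products of
  operators are Kronecker products.
\<close>

definition hermitian :: "complex^'n^'n \<Rightarrow> bool" where
  "hermitian A \<longleftrightarrow> (\<forall>i j. A $ i $ j = cnj (A $ j $ i))"

definition pos_semidef :: "complex^'n^'n \<Rightarrow> bool" where
  "pos_semidef A \<longleftrightarrow>
     hermitian A \<and> (\<forall>v. (\<Sum>i\<in>UNIV. cnj (v $ i) * (A *v v) $ i) \<in> \<real>\<^sub>\<ge>\<^sub>0)"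

definition state :: "complex^'n^'n \<Rightarrow> bool" where
  "state \<rho> \<longleftrightarrow> pos_semidef \<rho> \<and> trace \<rho> = 1"

definition kron :: "complex^('m::finite)^'m \<Rightarrow> complex^('n::finite)^'n \<Rightarrow> complex^('m \<times> 'n)^('m \<times> 'n)"
    (infixl "\<otimes>\<^sub>K" 70) where
  "A \<otimes>\<^sub>K B = (\<chi> i j. A $ fst i $ fst j * B $ snd i $ snd j)"

definition separable :: "complex^('d::finite \<times> 'd)^('d \<times> 'd) \<Rightarrow> bool" where
  "separable \<rho> \<longleftrightarrow> state \<rho> \<and>
     (\<exists>(n::nat) (c :: nat \<Rightarrow> real) (\<sigma> :: nat \<Rightarrow> complex^'d^'d) (\<eta> :: nat \<Rightarrow> complex^'d^'d).
        (\<forall>i<n. 0 \<le> c i \<and> state (\<sigma> i) \<and> state (\<eta> i)) \<and> (\<Sum>i<n. c i) = 1 \<and>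
        \<rho> = (\<Sum>i<n. c i *\<^sub>R (\<sigma> i \<otimes>\<^sub>K \<eta> i)))"

definition entangled :: "complex^('d::finite \<times> 'd)^('d \<times> 'd) \<Rightarrow> bool" where
  "entangled \<rho> \<longleftrightarrow> state \<rho> \<and> \<not> separable \<rho>"

definition povm :: "'j set \<Rightarrow> ('j \<Rightarrow> complex^'n^'n) \<Rightarrow> bool" where
  "povm J E \<longleftrightarrow> finite J \<and> (\<forall>j\<in>J. pos_semidef (E j)) \<and> (\<Sum>j\<in>J. E j) = mat 1"

definition povm_annihilator :: "'j set \<Rightarrow> ('j \<Rightarrow> complex^'n^'n) \<Rightarrow> (complex^'n^'n) set" where
  "povm_annihilator J E = {\<Delta>. hermitian \<Delta> \<and> (\<forall>j\<in>J. trace (\<Delta> ** E j) = 0)}"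

definition informationally_complete :: "'j set \<Rightarrow> ('j \<Rightarrow> complex^'n^'n) \<Rightarrow> bool" where
  "informationally_complete J E \<longleftrightarrow> povm_annihilator J E = {0}"

definition determines_separability ::
    "'j set \<Rightarrow> ('j \<Rightarrow> complex^('d::finite \<times> 'd)^('d \<times> 'd)) \<Rightarrow> bool" where
  "determines_separability J E \<longleftrightarrow>
     \<not> (\<exists>\<rho>\<^sub>1 \<rho>\<^sub>2. separable \<rho>\<^sub>1 \<and> entangled \<rho>\<^sub>2 \<and>
          (\<forall>j\<in>J. trace (\<rho>\<^sub>1 ** E j) = trace (\<rho>\<^sub>2 ** E j)))"

end

theory Submission
  imports Defs
begin

text \<open>
  Let \<open>F\<close> be the flip operator. The functional \<open>W\<^sub>A(X) = tr[F (A \<otimes> 1) X (A\<^sup>* \<otimes> 1)]\<close> maps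
  \<open>\<sigma> \<otimes> \<eta>\<close> to \<open>tr[A \<sigma> A\<^sup>* \<eta>]\<close>, so it is nonnegative on separable states. If \<open>A\<close> is invertible it
  vanishes on a separable state \<open>\<rho>\<close> of full rank: mix product vectors \<open>A\<^sup>-\<^sup>1 x \<otimes> y\<close> with \<open>x\<close>
  orthogonal to \<open>y\<close>. For \<open>\<Delta>\<close> in the annihilator and small real \<open>t\<close>, \<open>\<rho> + t \<Delta>\<close> is still a state with
  the outcome probabilities of \<open>\<rho>\<close>; if \<open>W\<^sub>A(\<Delta>) \<noteq> 0\<close>, a suitable sign of \<open>t\<close> makes \<open>W\<^sub>A\<close> negative on
  it, so it is entangled. Hence \<open>W\<^sub>A(\<Delta>) = 0\<close> for all invertible \<open>A\<close>. As \<open>W\<^sub>A(\<Delta>)\<close> is a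
  sesquilinear form in \<open>A\<close>, its values at \<open>1 + t B\<close> for small \<open>t\<close> and polarisation give \<open>\<Delta> = 0\<close>.
\<close>

section \<open>Quadratic forms of Hermitian matrices\<close>

definition qform :: "complex^'n^'n \<Rightarrow> complex^'n \<Rightarrow> complex" where
  "qform A v = (\<Sum>i\<in>UNIV. cnj (v $ i) * (A *v v) $ i)"

lemma qform_sum: "qform A v = (\<Sum>i\<in>UNIV. \<Sum>j\<in>UNIV. cnj (v $ i) * A $ i $ j * v $ j)"
  by (simp add: qform_def matrix_vector_mult_def sum_distrib_left mult.assoc)

lemma qform_add: "qform (A + B) v = qform A v + qform B v"
  by (simp add: qform_sum algebra_simps sum.distrib)

lemma qform_diff: "qform (A - B) v = qform A v - qform B v"
  by (simp add: qform_sum algebra_simps sum_subtractf)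

lemma qform_scaleR: "qform (c *\<^sub>R A) v = c *\<^sub>R qform A v"
  by (simp add: qform_sum scaleR_sum_right)

lemma qform_zero [simp]: "qform 0 v = 0"
  by (simp add: qform_sum)

lemma qform_matrix_sum: "qform (\<Sum>k\<in>K. A k) v = (\<Sum>k\<in>K. qform (A k) v)"
  by (induction K rule: infinite_finite_induct) (simp_all add: qform_add)

lemma qform_scaleR_arg: "qform A (c *\<^sub>R v) = c\<^sup>2 *\<^sub>R qform A v"
  unfolding qform_sum scaleR_sum_right
  by (intro sum.cong refl) (simp, simp add: scaleR_conv_of_real power2_eq_square)

lemma hermitianD: "hermitian A \<Longrightarrow> cnj (A $ i $ j) = A $ j $ i"
  unfolding hermitian_def by metis

lemma hermitianI: "(\<And>i j. cnj (A $ i $ j) = A $ j $ i) \<Longrightarrow> hermitian A"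
  unfolding hermitian_def by metis

lemma hermitian_zero: "hermitian 0"
  by (rule hermitianI) simp

lemma hermitian_add: "hermitian A \<Longrightarrow> hermitian B \<Longrightarrow> hermitian (A + B)"
  by (rule hermitianI) (simp add: hermitianD)

lemma hermitian_diff: "hermitian A \<Longrightarrow> hermitian B \<Longrightarrow> hermitian (A - B)"
  by (rule hermitianI) (simp add: hermitianD)

lemma hermitian_scaleR: "hermitian A \<Longrightarrow> hermitian (c *\<^sub>R A)"
  by (rule hermitianI) (simp add: hermitianD)

lemma hermitian_qform_cnj:
  assumes "hermitian A"
  shows "cnj (qform A v) = qform A v"
proof -
  have "cnj (qform A v) = (\<Sum>i\<in>UNIV. \<Sum>j\<in>UNIV. cnj (v $ j) * A $ j $ i * v $ i)"
    by (simp add: qform_sum hermitianD[OF assms] mult_ac)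
  also have "\<dots> = qform A v"
    unfolding qform_sum by (rule sum.swap)
  finally show ?thesis .
qed

text \<open>A Hermitian form takes only real values, so positivity can be read off the real part;
  later sign arguments all use this form.\<close>

lemma pos_semidef_iff: "pos_semidef A \<longleftrightarrow> hermitian A \<and> (\<forall>v. 0 \<le> Re (qform A v))"
proof -
  have "Im (qform A v) = 0" if "hermitian A" for v
    using hermitian_qform_cnj[OF that, of v] by (simp add: complex_eq_iff)
  then show ?thesis
    by (auto simp: pos_semidef_def qform_def[symmetric] complex_nonneg_Reals_iff)
qed

section \<open>Rank-one decomposition of positive semidefinite matrices\<close>

definition outer :: "complex^'n \<Rightarrow> complex^'n^'n" where
  "outer x = (\<chi> i j. x $ i * cnj (x $ j))"

lemma hermitian_outer: "hermitian (outer x)"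
  by (simp add: hermitian_def outer_def)

lemma qform_outer: "qform (outer x) v = of_real ((cmod (\<Sum>i\<in>UNIV. cnj (v $ i) * x $ i))\<^sup>2)"
proof -
  have "qform (outer x) v = (\<Sum>i\<in>UNIV. cnj (v $ i) * x $ i) * cnj (\<Sum>i\<in>UNIV. cnj (v $ i) * x $ i)"
    unfolding qform_sum cnj_sum sum_product by (simp add: outer_def mult_ac)
  then show ?thesis
    by (simp only: complex_norm_square)
qed

lemma pos_semidef_outer: "pos_semidef (outer x)"
  by (simp add: pos_semidef_iff hermitian_outer qform_outer del: of_real_power)

lemma trace_outer: "trace (outer x) = of_real ((norm x)\<^sup>2)"
proof -
  have "(norm x)\<^sup>2 = (\<Sum>i\<in>UNIV. (cmod (x $ i))\<^sup>2)"
    by (simp add: norm_vec_def L2_set_def sum_nonneg)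
  then show ?thesis
    by (simp add: trace_def outer_def complex_norm_square del: of_real_power)
qed

lemma sum_axis: "(\<Sum>i\<in>UNIV. f i * axis k a $ i) = f k * (a::complex)"
proof -
  have "(\<Sum>i\<in>UNIV. f i * axis k a $ i) = (\<Sum>i\<in>UNIV. if i = k then f k * a else 0)"
    by (intro sum.cong) (auto simp: axis_def)
  then show ?thesis by simp
qed

lemma matrix_vector_mult_axis: "((A::complex^'n^'m) *v axis l a) $ k = A $ k $ l * a"
  by (simp add: matrix_vector_mult_def sum_axis del: mult_cancel_left)

text \<open>How the form reacts to a change of one coordinate. As a quadratic polynomial in
  \<open>a\<close> it serves both for vanishing diagonal entries and for completing the
  square.\<close>

lemma qform_add_axis:
  assumes "hermitian A"
  shows "qform A (v + axis k a) =
    qform A v + cnj a * (A *v v) $ k + a * cnj ((A *v v) $ k) + cnj a * a * A $ k $ k"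
proof -
  have 1: "(\<Sum>i\<in>UNIV. cnj (axis k a $ i) * w i) = cnj a * w k" for w
  proof -
    have "cnj (axis k a $ i) = axis k (cnj a) $ i" for i by (simp add: axis_def)
    then show ?thesis by (simp add: mult.commute[of _ "w _"] sum_axis)
  qed
  note 2 = matrix_vector_mult_axis
  have 3: "(\<Sum>i\<in>UNIV. cnj (v $ i) * (A *v axis k a) $ i) = a * cnj ((A *v v) $ k)"
    by (simp add: 2) (simp add: matrix_vector_mult_def hermitianD[OF assms] sum_distrib_left mult_ac)
  have "qform A (v + axis k a) =
     qform A v + (\<Sum>i\<in>UNIV. cnj (axis k a $ i) * (A *v v) $ i)
     + (\<Sum>i\<in>UNIV. cnj (v $ i) * (A *v axis k a) $ i)
     + (\<Sum>i\<in>UNIV. cnj (axis k a $ i) * (A *v axis k a) $ i)"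
    unfolding qform_def
    by (simp add: matrix_vector_right_distrib distrib_left distrib_right sum.distrib)
  then show ?thesis
    unfolding 3 unfolding 1 unfolding 2 by (simp add: mult_ac)
qed

lemma qform_axis: "hermitian A \<Longrightarrow> qform A (axis k 1) = A $ k $ k"
  using qform_add_axis[of A 0 k 1] by (simp add: qform_def)

lemma pos_semidefD:
  assumes "pos_semidef A"
  shows "hermitian A" "0 \<le> Re (qform A v)"
  using assms by (simp_all add: pos_semidef_iff)

lemma pos_semidef_diag:
  assumes A: "pos_semidef A"
  shows "A $ k $ k = of_real (Re (A $ k $ k))" "0 \<le> Re (A $ k $ k)"
proof -
  have "cnj (A $ k $ k) = A $ k $ k"
    by (rule hermitianD[OF pos_semidefD(1)[OF A]])
  then show "A $ k $ k = of_real (Re (A $ k $ k))"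
    by (simp add: complex_eq_iff)
  show "0 \<le> Re (A $ k $ k)"
    using pos_semidefD(2)[OF A, of "axis k 1"] by (simp add: qform_axis[OF pos_semidefD(1)[OF A]])
qed

text \<open>With a zero diagonal entry, the form at \<open>axis l 1 + axis k a\<close> has no
  quadratic term in \<open>a\<close>; a nonzero linear coefficient would make it unbounded
  below.\<close>

lemma pos_semidef_zero_diag:
  assumes A: "pos_semidef A" and "A $ k $ k = 0"
  shows "A $ k $ l = 0"
proof (rule ccontr)
  assume nz: "A $ k $ l \<noteq> 0"
  have h: "hermitian A" using A by (simp add: pos_semidef_iff)
  define z where "z = A $ k $ l"
  define b where "b = Re (A $ l $ l)"
  \<comment> \<open>Chosen so that the linear term \<open>2 * s * (cmod z)\<^sup>2\<close> equals
    \<open>b + 1\<close> and the form takes the value -1.\<close>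
  define s where "s = (b + 1) / (2 * (cmod z)\<^sup>2)"
  have "z * cnj z = of_real ((cmod z)\<^sup>2)" by (simp only: complex_norm_square)
  then have zz: "Re (z * cnj z) = (cmod z)\<^sup>2" by simp
  have "qform A (axis l 1 + axis k (- of_real s * z)) =
      A $ l $ l - 2 * of_real s * (z * cnj z)"
    by (simp add: qform_add_axis[OF h] qform_axis[OF h] matrix_vector_mult_axis assms(2) z_def[symmetric])
  then have "Re (qform A (axis l 1 + axis k (- of_real s * z))) = b - 2 * s * (cmod z)\<^sup>2"
    using zz by (simp add: b_def)
  moreover have "2 * s * (cmod z)\<^sup>2 = b + 1"
    using nz by (simp add: s_def z_def)
  ultimately have "Re (qform A (axis l 1 + axis k (- of_real s * z))) < 0" by simp
  then show False using pos_semidefD(2)[OF A, of "axis l 1 + axis k (- of_real s * z)"] by linarith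
qed

text \<open>One Cholesky elimination step: \<open>outer x\<close> agrees with \<open>A\<close> in
  row and column \<open>k\<close>, and completing the square in coordinate \<open>k\<close> shows
  that the remainder is still positive. Zero diagonal entries persist, so their number strictly
  grows.\<close>

lemma pos_semidef_schur_complement:
  assumes A: "pos_semidef A" and k: "A $ k $ k \<noteq> 0"
  defines "x \<equiv> (\<chi> i. A $ i $ k / of_real (sqrt (Re (A $ k $ k))))"
  shows "pos_semidef (A - outer x)" "(A - outer x) $ k $ k = 0"
    and "\<And>l. A $ l $ l = 0 \<Longrightarrow> (A - outer x) $ l $ l = 0"
proof -
  have h: "hermitian A" using A by (simp add: pos_semidef_iff)
  define r where "r = Re (A $ k $ k)"
  have r: "A $ k $ k = of_real r" "r > 0"
  proof -
    show *: "A $ k $ k = of_real r"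
      unfolding r_def by (rule pos_semidef_diag(1)[OF A])
    have "r \<noteq> 0" using k unfolding * by simp
    then show "r > 0"
      using pos_semidef_diag(2)[OF A, of k] unfolding r_def by linarith
  qed
  have sq: "complex_of_real (sqrt r) * of_real (sqrt r) = of_real r"
    using r(2) by (simp flip: of_real_mult)
  have out: "outer x $ i $ j = A $ i $ k * A $ k $ j / of_real r" for i j
    using r(2) by (simp add: outer_def x_def r_def[symmetric] hermitianD[OF h] sq)
  show "(A - outer x) $ k $ k = 0"
    using r by (simp add: out)
  show "(A - outer x) $ l $ l = 0" if "A $ l $ l = 0" for l
    using pos_semidef_zero_diag[OF A that, of k] that by (simp add: out)
  have "0 \<le> Re (qform (A - outer x) v)" for v
  proof -
    define s where "s = (A *v v) $ k"
    have "qform (outer x) v = (\<Sum>i\<in>UNIV. \<Sum>j\<in>UNIV. (cnj (v $ i) * A $ i $ k) * (A $ k $ j * v $ j)) / of_real r"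
      by (simp add: qform_sum out sum_divide_distrib mult_ac)
    also have "\<dots> = (\<Sum>i\<in>UNIV. cnj (v $ i) * A $ i $ k) * (\<Sum>j\<in>UNIV. A $ k $ j * v $ j) / of_real r"
      by (simp only: sum_product)
    also have "\<dots> = cnj s * s / of_real r"
      by (simp add: s_def matrix_vector_mult_def hermitianD[OF h] mult_ac)
    finally have o: "qform (outer x) v = cnj s * s / of_real r" .
    \<comment> \<open>The shift \<open>- s / r\<close> minimises the form of \<open>A\<close> along
      the \<open>k\<close>-th axis.\<close>
    have "qform A (v + axis k (- s / of_real r)) = qform A v - cnj s * s / of_real r"
      unfolding qform_add_axis[OF h] r(1) s_def[symmetric] using r(2) by (simp add: mult_ac)
    then have "qform (A - outer x) v = qform A (v + axis k (- s / of_real r))"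
      by (simp add: qform_diff o)
    then show ?thesis using A by (simp add: pos_semidef_iff)
  qed
  moreover have "hermitian (A - outer x)"
    by (intro hermitian_diff h hermitian_outer)
  ultimately show "pos_semidef (A - outer x)" by (simp add: pos_semidef_iff)
qed

text \<open>Eliminating one nonzero diagonal entry at a time gives rank-one terms without
  eigenvectors; the number of nonzero diagonal entries is the induction measure.\<close>

lemma pos_semidef_sum_outer:
  assumes "pos_semidef A"
  shows "\<exists>ws. A = sum_list (map outer ws)"
  using assms
proof (induction "card {k. A $ k $ k \<noteq> 0}" arbitrary: A rule: less_induct)
  case less
  show ?case
  proof (cases "\<exists>k. A $ k $ k \<noteq> 0")
    case False
    then have "A = sum_list (map outer [])"
      using pos_semidef_zero_diag[OF less.prems] by (simp add: vec_eq_iff)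
    then show ?thesis by blast
  next
    case True
    then obtain k where k: "A $ k $ k \<noteq> 0" by blast
    define x where "x = (\<chi> i. A $ i $ k / of_real (sqrt (Re (A $ k $ k))))"
    note S = pos_semidef_schur_complement[OF less.prems k, folded x_def]
    have "{l. (A - outer x) $ l $ l \<noteq> 0} \<subset> {l. A $ l $ l \<noteq> 0}"
      using S(2,3) k by blast
    then have "card {l. (A - outer x) $ l $ l \<noteq> 0} < card {l. A $ l $ l \<noteq> 0}"
      by (intro psubset_card_mono) auto
    from less.hyps[OF this S(1)] obtain ws where "A - outer x = sum_list (map outer ws)" by blast
    then have "A = sum_list (map outer (x # ws))" by (simp add: algebra_simps)
    then show ?thesis by blast
  qed
qed

section \<open>The witness functional and its sign on separable states\<close>

text \<open>\<open>witness A B X\<close> is the trace of \<open>F (A \<otimes> 1) X (B\<^sup>* \<otimes> 1)\<close>, where \<open>F\<close> is the flip operator.\<close>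

definition witness ::
    "complex^('d::finite)^'d \<Rightarrow> complex^'d^'d \<Rightarrow> complex^('d \<times> 'd)^('d \<times> 'd) \<Rightarrow> complex" where
  "witness A B X = (\<Sum>i\<in>UNIV. \<Sum>p\<in>UNIV. \<Sum>j\<in>UNIV. \<Sum>q\<in>UNIV.
     A $ i $ p * cnj (B $ j $ q) * X $ (p, j) $ (q, i))"

lemma witness_add: "witness A B (X + Y) = witness A B X + witness A B Y"
  by (simp add: witness_def distrib_left sum.distrib)

lemma witness_scaleR: "witness A B (c *\<^sub>R X) = c *\<^sub>R witness A B X"
  by (simp add: witness_def scaleR_sum_right)

lemma witness_zero [simp]: "witness A B 0 = 0"
  by (simp add: witness_def)

lemma witness_matrix_sum: "witness A B (\<Sum>k\<in>K. X k) = (\<Sum>k\<in>K. witness A B (X k))"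
  by (induction K rule: infinite_finite_induct) (simp_all add: witness_add)

lemma witness_add_left: "witness (A + A') B X = witness A B X + witness A' B X"
  by (simp add: witness_def distrib_right sum.distrib)

lemma witness_add_right: "witness A (B + B') X = witness A B X + witness A B' X"
  by (simp add: witness_def distrib_left distrib_right sum.distrib)

lemma witness_scale_left: "witness (\<chi> i j. c * A $ i $ j) B X = c * witness A B X"
  by (simp add: witness_def sum_distrib_left mult_ac)

lemma witness_scale_right: "witness A (\<chi> i j. c * B $ i $ j) X = cnj c * witness A B X"
  by (simp add: witness_def sum_distrib_left mult_ac)

lemma sum_swap_pairs:
  "(\<Sum>i\<in>I. \<Sum>p\<in>P. \<Sum>j\<in>J. \<Sum>q\<in>Q. f i p j q) = (\<Sum>j\<in>J. \<Sum>q\<in>Q. \<Sum>i\<in>I. \<Sum>p\<in>P. f i p j q)"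
proof -
  have "(\<Sum>p\<in>P. \<Sum>j\<in>J. \<Sum>q\<in>Q. f i p j q) = (\<Sum>j\<in>J. \<Sum>q\<in>Q. \<Sum>p\<in>P. f i p j q)" for i
    by (rule trans[OF sum.swap]) (rule sum.cong[OF refl], rule sum.swap)
  then have "(\<Sum>i\<in>I. \<Sum>p\<in>P. \<Sum>j\<in>J. \<Sum>q\<in>Q. f i p j q) = (\<Sum>i\<in>I. \<Sum>j\<in>J. \<Sum>q\<in>Q. \<Sum>p\<in>P. f i p j q)"
    by simp
  also have "\<dots> = (\<Sum>j\<in>J. \<Sum>i\<in>I. \<Sum>q\<in>Q. \<Sum>p\<in>P. f i p j q)"
    by (rule sum.swap)
  also have "\<dots> = (\<Sum>j\<in>J. \<Sum>q\<in>Q. \<Sum>i\<in>I. \<Sum>p\<in>P. f i p j q)"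
    by (rule sum.cong[OF refl]) (rule sum.swap)
  finally show ?thesis .
qed

text \<open>Conjugation exchanges the index pairs \<open>(i, p)\<close> and \<open>(j, q)\<close>.
  For \<open>A = B\<close> the witness value is therefore real.\<close>

lemma witness_cnj:
  assumes "hermitian X"
  shows "cnj (witness A B X) = witness B A X"
proof -
  have "cnj (witness A B X) = (\<Sum>i\<in>UNIV. \<Sum>p\<in>UNIV. \<Sum>j\<in>UNIV. \<Sum>q\<in>UNIV.
     B $ j $ q * cnj (A $ i $ p) * X $ (q, i) $ (p, j))"
    by (simp add: witness_def hermitianD[OF assms] mult_ac)
  also have "\<dots> = witness B A X"
    unfolding witness_def by (rule sum_swap_pairs)
  finally show ?thesis .
qed

lemma kron_add_right: "A \<otimes>\<^sub>K (B + C) = A \<otimes>\<^sub>K B + A \<otimes>\<^sub>K C"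
  by (simp add: kron_def vec_eq_iff distrib_left)

lemma kron_zero_right: "A \<otimes>\<^sub>K 0 = 0"
  by (simp add: kron_def vec_eq_iff)

lemma kron_scaleR: "(a *\<^sub>R A) \<otimes>\<^sub>K (b *\<^sub>R B) = (a * b) *\<^sub>R (A \<otimes>\<^sub>K B)"
  by (simp add: kron_def vec_eq_iff)

text \<open>The vector on the right is the adjoint of \<open>A\<close> applied to \<open>w\<close>:
  the trace of A \<sigma> A* against the rank-one operator of \<open>w\<close> is the form of
  \<sigma> at A* w.\<close>

lemma witness_kron_outer:
  "witness A A (\<sigma> \<otimes>\<^sub>K outer w) = qform \<sigma> (\<chi> q. \<Sum>j\<in>UNIV. cnj (A $ j $ q) * w $ j)"
proof -
  have "qform \<sigma> (\<chi> q. \<Sum>j\<in>UNIV. cnj (A $ j $ q) * w $ j) =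
     (\<Sum>p\<in>UNIV. \<Sum>q\<in>UNIV. \<Sum>i\<in>UNIV. \<Sum>j\<in>UNIV.
       A $ i $ p * cnj (A $ j $ q) * (\<sigma> $ p $ q * (w $ j * cnj (w $ i))))"
    by (simp add: qform_sum sum_distrib_left sum_distrib_right mult_ac)
  also have "\<dots> = (\<Sum>p\<in>UNIV. \<Sum>i\<in>UNIV. \<Sum>q\<in>UNIV. \<Sum>j\<in>UNIV.
       A $ i $ p * cnj (A $ j $ q) * (\<sigma> $ p $ q * (w $ j * cnj (w $ i))))"
    by (rule sum.cong[OF refl]) (rule sum.swap)
  also have "\<dots> = (\<Sum>i\<in>UNIV. \<Sum>p\<in>UNIV. \<Sum>q\<in>UNIV. \<Sum>j\<in>UNIV.
       A $ i $ p * cnj (A $ j $ q) * (\<sigma> $ p $ q * (w $ j * cnj (w $ i))))"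
    by (rule sum.swap)
  also have "\<dots> = (\<Sum>i\<in>UNIV. \<Sum>p\<in>UNIV. \<Sum>j\<in>UNIV. \<Sum>q\<in>UNIV.
       A $ i $ p * cnj (A $ j $ q) * (\<sigma> $ p $ q * (w $ j * cnj (w $ i))))"
    by (rule sum.cong[OF refl], rule sum.cong[OF refl]) (rule sum.swap)
  also have "\<dots> = witness A A (\<sigma> \<otimes>\<^sub>K outer w)"
    by (simp add: witness_def kron_def outer_def)
  finally show ?thesis by simp
qed

text \<open>By linearity only the second factor has to be split into rank-one terms; each of them
  contributes a value of the form of \<sigma>.\<close>

lemma witness_kron_nonneg:
  assumes "pos_semidef \<sigma>" "pos_semidef \<eta>"
  shows "0 \<le> Re (witness A A (\<sigma> \<otimes>\<^sub>K \<eta>))"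
proof -
  obtain ws where ws: "\<eta> = sum_list (map outer ws)"
    using pos_semidef_sum_outer[OF assms(2)] by blast
  have "0 \<le> Re (witness A A (\<sigma> \<otimes>\<^sub>K sum_list (map outer ws)))"
    using assms(1)
    by (induction ws)
       (auto simp: kron_zero_right kron_add_right witness_add witness_kron_outer pos_semidef_iff)
  then show ?thesis by (simp add: ws)
qed

lemma witness_separable_nonneg:
  assumes "separable \<rho>"
  shows "0 \<le> Re (witness A A \<rho>)"
proof -
  obtain n :: nat and c :: "nat \<Rightarrow> real" and \<sigma> \<eta> where
    st: "\<forall>i<n. 0 \<le> c i \<and> state (\<sigma> i) \<and> state (\<eta> i)"
    and \<rho>: "\<rho> = (\<Sum>i<n. c i *\<^sub>R (\<sigma> i \<otimes>\<^sub>K \<eta> i))"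
    using assms unfolding separable_def by blast
  have "0 \<le> c i * Re (witness A A (\<sigma> i \<otimes>\<^sub>K \<eta> i))" if "i < n" for i
    using st that by (auto simp: state_def intro!: mult_nonneg_nonneg witness_kron_nonneg)
  then show ?thesis
    by (auto simp: \<rho> witness_matrix_sum witness_scaleR intro!: sum_nonneg)
qed

section \<open>Full-rank separable states on which the witness vanishes\<close>

lemma kron_outer:
  "outer x \<otimes>\<^sub>K outer y = outer (\<chi> i. x $ fst i * y $ snd i)"
  by (simp add: kron_def outer_def vec_eq_iff mult_ac)

lemma trace_kron: "trace (A \<otimes>\<^sub>K B) = trace A * trace B"
  by (simp add: trace_def kron_def sum_product sum.cartesian_product split_beta)

lemma trace_scaleR: "trace (c *\<^sub>R (A::complex^'n^'n)) = c *\<^sub>R trace A"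
  by (simp add: trace_def scaleR_sum_right)

lemma trace_matrix_sum: "trace (\<Sum>k\<in>K. (A k :: complex^'n^'n)) = (\<Sum>k\<in>K. trace (A k))"
  by (induction K rule: infinite_finite_induct, simp_all add: trace_add) (simp_all add: trace_def)

lemma pos_semidef_scaleR: "pos_semidef A \<Longrightarrow> 0 \<le> c \<Longrightarrow> pos_semidef (c *\<^sub>R A)"
  by (simp add: pos_semidef_iff qform_scaleR hermitian_scaleR)

lemma pos_semidef_sum:
  assumes "\<And>k. k \<in> K \<Longrightarrow> pos_semidef (A k)"
  shows "pos_semidef (\<Sum>k\<in>K. A k)"
  using assms
  by (induction K rule: infinite_finite_induct) (simp_all add: pos_semidef_iff qform_add hermitian_add hermitian_zero)

lemma state_normalised_outer: "x \<noteq> 0 \<Longrightarrow> state ((1 / (norm x)\<^sup>2) *\<^sub>R outer x)"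
  by (simp add: state_def pos_semidef_scaleR pos_semidef_outer trace_scaleR trace_outer)
    (simp add: scaleR_conv_of_real)

text \<open>Allows unnormalised product vectors: the squared norms \<open>m k\<close>, divided by
  their sum \<open>N\<close>, become the convex weights, and \<open>N\<close> is the trace of the
  unnormalised sum.\<close>

lemma separable_sum_outer:
  fixes x y :: "'k \<Rightarrow> complex^'d::finite"
  assumes K: "finite K" "K \<noteq> {}" and nz: "\<And>k. k \<in> K \<Longrightarrow> x k \<noteq> 0 \<and> y k \<noteq> 0"
  shows "\<exists>N>0. separable ((1 / N) *\<^sub>R (\<Sum>k\<in>K. outer (x k) \<otimes>\<^sub>K outer (y k)))"
proof -
  define m where "m k = (norm (x k))\<^sup>2 * (norm (y k))\<^sup>2" for k
  define N where "N = (\<Sum>k\<in>K. m k)"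
  define \<rho> where "\<rho> = (1 / N) *\<^sub>R (\<Sum>k\<in>K. outer (x k) \<otimes>\<^sub>K outer (y k))"
  define \<sigma> where "\<sigma> k = (1 / (norm (x k))\<^sup>2) *\<^sub>R outer (x k)" for k
  define \<eta> where "\<eta> k = (1 / (norm (y k))\<^sup>2) *\<^sub>R outer (y k)" for k
  have mpos: "m k > 0" if "k \<in> K" for k
    using nz[OF that] by (simp add: m_def)
  have N: "N > 0"
    unfolding N_def using K mpos by (intro sum_pos) auto
  \<comment> \<open>An enumeration of \<open>K\<close> is needed because \<open>separable\<close>
    indexes its mixtures by initial segments of the naturals.\<close>
  obtain h where h: "bij_betw h {..<card K} K"
    using ex_bij_betw_nat_finite[OF K(1)] by (auto simp: atLeast0LessThan)
  have hK: "h i \<in> K" if "i < card K" for i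
    using h that by (auto simp: bij_betw_def)
  have "pos_semidef \<rho>"
    unfolding \<rho>_def kron_outer using N
    by (intro pos_semidef_scaleR pos_semidef_sum pos_semidef_outer) auto
  moreover have "trace \<rho> = 1"
  proof -
    have "trace \<rho> = (1 / N) *\<^sub>R (\<Sum>k\<in>K. of_real (m k))"
      unfolding \<rho>_def by (simp add: trace_scaleR trace_matrix_sum trace_kron trace_outer m_def)
    also have "\<dots> = 1" using N by (simp add: N_def[symmetric] scaleR_conv_of_real flip: of_real_sum)
    finally show ?thesis .
  qed
  ultimately have "state \<rho>" by (simp add: state_def)
  moreover have "\<forall>i<card K. 0 \<le> m (h i) / N \<and> state (\<sigma> (h i)) \<and> state (\<eta> (h i))"
    using N mpos hK nz by (auto simp: \<sigma>_def \<eta>_def less_imp_le intro!: state_normalised_outer)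
  moreover have "(\<Sum>i<card K. m (h i) / N) = 1"
    using N sum.reindex_bij_betw[OF h, of "\<lambda>k. m k / N"]
    by (simp add: N_def[symmetric] flip: sum_divide_distrib)
  moreover have "\<rho> = (\<Sum>i<card K. (m (h i) / N) *\<^sub>R (\<sigma> (h i) \<otimes>\<^sub>K \<eta> (h i)))"
  proof -
    have "(\<Sum>i<card K. (m (h i) / N) *\<^sub>R (\<sigma> (h i) \<otimes>\<^sub>K \<eta> (h i)))
        = (\<Sum>k\<in>K. (m k / N) *\<^sub>R (\<sigma> k \<otimes>\<^sub>K \<eta> k))"
      by (rule sum.reindex_bij_betw[OF h])
    also have "\<dots> = (\<Sum>k\<in>K. (1 / N) *\<^sub>R (outer (x k) \<otimes>\<^sub>K outer (y k)))"
      using nz by (intro sum.cong) (auto simp: \<sigma>_def \<eta>_def kron_scaleR m_def)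
    also have "\<dots> = \<rho>" by (simp add: \<rho>_def scaleR_sum_right)
    finally show ?thesis by simp
  qed
  ultimately have "separable \<rho>"
    unfolding separable_def
    by (intro conjI exI[of _ "card K"] exI[of _ "\<lambda>i. m (h i) / N"] exI[of _ "\<lambda>i. \<sigma> (h i)"]
        exI[of _ "\<lambda>i. \<eta> (h i)"])
  then show ?thesis using N by (auto simp: \<rho>_def)
qed

text \<open>Pairs of orthogonal vectors whose tensor products span the whole space as soon as \<open>d \<ge> 2\<close>.\<close>

definition orth_pairs :: "((complex^'d) \<times> (complex^'d)) set" where
  "orth_pairs = (\<Union>i. \<Union>j\<in>-{i}. insert (axis i 1, axis j 1)
     ((\<lambda>\<omega>. (axis i 1 + axis j \<omega>, axis i 1 - axis j \<omega>)) ` {1, \<i>}))"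

lemma finite_orth_pairs: "finite orth_pairs"
  unfolding orth_pairs_def by auto

lemma orth_pairs_nonzero:
  fixes x y :: "complex^'d"
  assumes "(x, y) \<in> orth_pairs"
  shows "x \<noteq> 0 \<and> y \<noteq> 0"
proof -
  have "axis i 1 + axis j \<omega> \<noteq> (0::complex^'d)" "axis i 1 - axis j \<omega> \<noteq> (0::complex^'d)"
    if "i \<noteq> j" for i j :: 'd and \<omega> :: complex
  proof -
    have "(axis i 1 + axis j \<omega> :: complex^'d) $ i = 1" "(axis i 1 - axis j \<omega> :: complex^'d) $ i = 1"
      using that by (simp_all add: axis_def)
    then show "axis i 1 + axis j \<omega> \<noteq> (0::complex^'d)" "axis i 1 - axis j \<omega> \<noteq> (0::complex^'d)"
      by (metis zero_index zero_neq_one)+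
  qed
  then show ?thesis
    using assms by (auto simp: orth_pairs_def axis_eq_0_iff)
qed

text \<open>For the pairs built with \<omega> the inner product is 1 - |\<omega>|^2, which is zero
  since \<omega> is 1 or the imaginary unit.\<close>

lemma orth_pairs_orthogonal:
  fixes x y :: "complex^'d"
  assumes "(x, y) \<in> orth_pairs"
  shows "(\<Sum>i\<in>UNIV. cnj (y $ i) * x $ i) = 0"
  using assms
  by (auto simp: orth_pairs_def distrib_left sum.distrib sum_axis)
    (auto simp: axis_def split: if_splits)

text \<open>The spanning property in dual form: a bilinear form that vanishes on all pairs is zero.
  Basis pairs kill the off-diagonal coefficients; the two values of \<omega> give
  \<open>u k k = u l l\<close> and \<open>u k k = - u l l\<close>.\<close>

lemma orth_pairs_total:
  fixes u :: "'d::finite \<Rightarrow> 'd \<Rightarrow> complex" and i j :: 'd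
  assumes "CARD('d) \<ge> 2"
    and 0: "\<And>x y. (x, y) \<in> orth_pairs \<Longrightarrow> (\<Sum>i\<in>UNIV. \<Sum>j\<in>UNIV. u i j * x $ i * y $ j) = 0"
  shows "u i j = 0"
proof -
  define \<beta> where "\<beta> x y = (\<Sum>i\<in>UNIV. \<Sum>j\<in>UNIV. u i j * x $ i * y $ j)" for x y :: "complex^'d"
  have add: "\<beta> (x + x') y = \<beta> x y + \<beta> x' y" "\<beta> x (y + y') = \<beta> x y + \<beta> x y'"
    "\<beta> x (y - y') = \<beta> x y - \<beta> x y'" for x x' y y'
    by (simp_all add: \<beta>_def algebra_simps sum.distrib sum_subtractf)
  have ax: "\<beta> (axis k a) (axis l b) = u k l * a * b" for k l a b
    unfolding \<beta>_def sum_axis by (simp add: sum_axis flip: sum_distrib_right)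
  have \<beta>0: "\<beta> x y = 0" if "(x, y) \<in> orth_pairs" for x y
    using 0[OF that] by (simp add: \<beta>_def)
  have off: "u k l = 0" if "k \<noteq> l" for k l
  proof -
    have "(axis k 1, axis l 1) \<in> orth_pairs" using that by (auto simp: orth_pairs_def)
    from \<beta>0[OF this] show ?thesis by (simp add: ax)
  qed
  have diag: "u k k - \<omega> * \<omega> * u l l = 0" if "k \<noteq> l" "\<omega> \<in> {1, \<i>}" for k l \<omega>
  proof -
    have "(axis k 1 + axis l \<omega>, axis k 1 - axis l \<omega>) \<in> orth_pairs"
      using that by (auto simp: orth_pairs_def)
    from \<beta>0[OF this] show ?thesis
      using off[OF that(1)] off[OF that(1)[symmetric]] by (simp add: add ax mult_ac)
  qed
  show ?thesis
  proof (cases "i = j")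
    case True
    \<comment> \<open>Dimension at least two enters here: a diagonal coefficient is compared with
      another one.\<close>
    have "\<exists>l. l \<noteq> i"
    proof (rule ccontr)
      assume "\<not> ?thesis"
      then have "(UNIV :: 'd set) = {i}" by auto
      then have "CARD('d) = 1" by (metis card_1_singleton_iff One_nat_def)
      with assms(1) show False by simp
    qed
    then obtain l where "i \<noteq> l" by metis
    from diag[OF this, of 1] diag[OF this, of \<i>] True show ?thesis by simp
  qed (rule off)
qed

text \<open>The state mixes the projectors on C x tensor y over the orthogonal pairs (x, y). Each
  contributes |<y, A C x>|^2 = |<y, x>|^2 = 0 to the witness, and the spanning property survives the
  invertible \<open>C\<close>, which gives full rank.\<close>

lemma full_rank_separable_witness_zero:
  fixes A C :: "complex^('d::finite)^'d"
  assumes d: "CARD('d) \<ge> 2" and AC: "A ** C = mat 1" "C ** A = mat 1"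
  shows "\<exists>\<rho>. separable \<rho> \<and> (\<forall>v. v \<noteq> 0 \<longrightarrow> 0 < Re (qform \<rho> v)) \<and> witness A A \<rho> = 0"
proof -
  define Z where "Z = (orth_pairs :: ((complex^'d) \<times> (complex^'d)) set)"
  define T where "T z = outer (C *v fst z) \<otimes>\<^sub>K outer (snd z)" for z :: "(complex^'d) \<times> (complex^'d)"
  have AC': "A *v (C *v x) = x" for x
    by (simp add: matrix_vector_mul_assoc AC(1))
  have nz: "C *v fst z \<noteq> 0 \<and> snd z \<noteq> 0" if "z \<in> Z" for z
    using orth_pairs_nonzero[of "fst z" "snd z"] that AC'[of "fst z"]
    by (auto simp: Z_def)
  have fin: "finite Z" by (simp add: Z_def finite_orth_pairs)
  \<comment> \<open>Without any pairs, totality would force the constant form 1 to vanish.\<close>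
  have ne: "Z \<noteq> {}"
  proof
    assume "Z = {}"
    then show False
      using orth_pairs_total[OF d, of "\<lambda>_ _. 1" undefined undefined] by (simp add: Z_def)
  qed
  obtain N where N: "N > 0" and sep: "separable ((1 / N) *\<^sub>R (\<Sum>z\<in>Z. T z))"
    using separable_sum_outer[OF fin ne, of "\<lambda>z. C *v fst z" snd] nz unfolding T_def by blast
  define \<rho> where "\<rho> = (1 / N) *\<^sub>R (\<Sum>z\<in>Z. T z)"
  have "witness A A (T z) = 0" if "z \<in> Z" for z
  proof -
    \<comment> \<open>Moving the adjoint across: <A* y, C x> = <y, A C x> = <y, x>.\<close>
    have "(\<Sum>p\<in>UNIV. cnj (\<Sum>j\<in>UNIV. cnj (A $ j $ p) * snd z $ j) * (C *v fst z) $ p)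
        = (\<Sum>p\<in>UNIV. \<Sum>j\<in>UNIV. cnj (snd z $ j) * (A $ j $ p * (C *v fst z) $ p))"
      by (simp add: sum_distrib_left sum_distrib_right mult_ac)
    also have "\<dots> = (\<Sum>j\<in>UNIV. \<Sum>p\<in>UNIV. cnj (snd z $ j) * (A $ j $ p * (C *v fst z) $ p))"
      by (rule sum.swap)
    also have "\<dots> = (\<Sum>j\<in>UNIV. cnj (snd z $ j) * (A *v (C *v fst z)) $ j)"
      by (simp only: matrix_vector_mult_def[of A] vec_lambda_beta sum_distrib_left)
    also have "\<dots> = 0"
      unfolding AC' using orth_pairs_orthogonal[of "fst z" "snd z"] that by (simp add: Z_def)
    finally show ?thesis
      by (simp add: T_def witness_kron_outer qform_outer)
  qed
  then have w0: "witness A A \<rho> = 0"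
    by (simp add: \<rho>_def witness_scaleR witness_matrix_sum)
  have pd: "0 < Re (qform \<rho> v)" if "v \<noteq> 0" for v
  proof (rule ccontr)
    \<comment> \<open>\<open>L z\<close> is the overlap of \<open>v\<close> with the product vector
      of \<open>z\<close>, so a form value that is not positive makes \<open>v\<close> orthogonal to
      all of these vectors.\<close>
    define L where "L z = (\<Sum>i\<in>UNIV. cnj (v $ i) * ((C *v fst z) $ fst i * snd z $ snd i))" for z
    have q: "Re (qform \<rho> v) = (\<Sum>z\<in>Z. (cmod (L z))\<^sup>2) / N"
      by (simp add: \<rho>_def T_def qform_scaleR qform_matrix_sum kron_outer qform_outer L_def
          del: of_real_power)
    assume "\<not> 0 < Re (qform \<rho> v)"
    then have "(\<Sum>z\<in>Z. (cmod (L z))\<^sup>2) \<le> 0"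
      using N by (simp add: q zero_less_divide_iff not_less)
    then have "(\<Sum>z\<in>Z. (cmod (L z))\<^sup>2) = 0"
      by (intro antisym sum_nonneg) auto
    then have L0: "L z = 0" if "z \<in> Z" for z
      using that fin by (simp add: sum_nonneg_eq_0_iff)
    \<comment> \<open>Coefficients of the bilinear form sending (x, y) to <v, C x tensor y>.\<close>
    define u where "u i j = (\<Sum>p\<in>UNIV. cnj (v $ (p, j)) * C $ p $ i)" for i j
    have uL: "(\<Sum>i\<in>UNIV. \<Sum>j\<in>UNIV. u i j * x $ i * y $ j) = L (x, y)" for x y
    proof -
      have "L (x, y) = (\<Sum>p\<in>UNIV. \<Sum>j\<in>UNIV. cnj (v $ (p, j)) * ((C *v x) $ p * y $ j))"
        unfolding L_def by (simp add: sum.cartesian_product split_beta)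
      also have "\<dots> = (\<Sum>p\<in>UNIV. \<Sum>j\<in>UNIV. \<Sum>i\<in>UNIV. cnj (v $ (p, j)) * C $ p $ i * x $ i * y $ j)"
        by (simp add: matrix_vector_mult_def sum_distrib_left sum_distrib_right mult_ac)
      also have "\<dots> = (\<Sum>j\<in>UNIV. \<Sum>p\<in>UNIV. \<Sum>i\<in>UNIV. cnj (v $ (p, j)) * C $ p $ i * x $ i * y $ j)"
        by (rule sum.swap)
      also have "\<dots> = (\<Sum>j\<in>UNIV. \<Sum>i\<in>UNIV. \<Sum>p\<in>UNIV. cnj (v $ (p, j)) * C $ p $ i * x $ i * y $ j)"
        by (rule sum.cong[OF refl]) (rule sum.swap)
      also have "\<dots> = (\<Sum>i\<in>UNIV. \<Sum>j\<in>UNIV. \<Sum>p\<in>UNIV. cnj (v $ (p, j)) * C $ p $ i * x $ i * y $ j)"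
        by (rule sum.swap)
      finally show ?thesis by (simp add: u_def sum_distrib_right)
    qed
    have u0: "u i j = 0" for i j
      by (rule orth_pairs_total[OF d, of u]) (unfold uL, rule L0, simp add: Z_def)
    have "cnj (v $ (p, j)) = 0" for p j
    proof -
      \<comment> \<open>Multiplying by \<open>A\<close> undoes \<open>C\<close> and recovers the
        conjugated entries of \<open>v\<close>.\<close>
      have "(\<Sum>i\<in>UNIV. u i j * A $ i $ p)
          = (\<Sum>i\<in>UNIV. \<Sum>r\<in>UNIV. cnj (v $ (r, j)) * (C $ r $ i * A $ i $ p))"
        by (simp add: u_def sum_distrib_left sum_distrib_right mult_ac)
      also have "\<dots> = (\<Sum>r\<in>UNIV. \<Sum>i\<in>UNIV. cnj (v $ (r, j)) * (C $ r $ i * A $ i $ p))"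
        by (rule sum.swap)
      also have "\<dots> = (\<Sum>r\<in>UNIV. cnj (v $ (r, j)) * (C ** A) $ r $ p)"
        by (simp add: matrix_matrix_mult_def sum_distrib_left)
      also have "\<dots> = (\<Sum>r\<in>UNIV. if r = p then cnj (v $ (p, j)) else 0)"
        unfolding AC(2) by (intro sum.cong) (auto simp: mat_def)
      finally show ?thesis by (simp add: u0)
    qed
    then have "v = 0" by (simp add: vec_eq_iff)
    with that show False by simp
  qed
  show ?thesis using sep w0 pd unfolding \<rho>_def by blast
qed

section \<open>Perturbing a full-rank state along the annihilator\<close>

text \<open>On the compact unit sphere the form of \<rho> has a minimum m > 0 and that of \<Delta>
  is bounded by some K, so |t| at most m / K is small enough; homogeneity covers all other
  vectors.\<close>

lemma pos_def_perturbation: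
  fixes \<rho> \<Delta> :: "complex^'n^'n"
  assumes h: "hermitian \<rho>" "hermitian \<Delta>"
    and pos: "\<And>v. v \<noteq> 0 \<Longrightarrow> 0 < Re (qform \<rho> v)"
  shows "\<exists>\<delta>>0. \<forall>t. \<bar>t\<bar> \<le> \<delta> \<longrightarrow> pos_semidef (\<rho> + t *\<^sub>R \<Delta>)"
proof -
  let ?S = "sphere (0::complex^'n) 1"
  have cont: "continuous_on ?S (\<lambda>v. Re (qform M v))" for M :: "complex^'n^'n"
    unfolding qform_sum by (intro continuous_intros)
  have ne: "?S \<noteq> {}" by (simp add: sphere_eq_empty)
  have cpt: "compact ?S" by simp
  obtain v0 where v0: "v0 \<in> ?S" "\<And>v. v \<in> ?S \<Longrightarrow> Re (qform \<rho> v0) \<le> Re (qform \<rho> v)"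
    using continuous_attains_inf[OF cpt ne cont] by blast
  obtain v1 where v1: "\<And>v. v \<in> ?S \<Longrightarrow> \<bar>Re (qform \<Delta> v)\<bar> \<le> \<bar>Re (qform \<Delta> v1)\<bar>"
    using continuous_attains_sup[OF cpt ne continuous_on_rabs[OF cont]] by blast
  define m where "m = Re (qform \<rho> v0)"
  \<comment> \<open>Adding 1 keeps \<open>K\<close> positive even if the form of \<Delta>
    vanishes.\<close>
  define K where "K = \<bar>Re (qform \<Delta> v1)\<bar> + 1"
  have "v0 \<noteq> 0" using v0(1) by auto
  then have m: "m > 0" by (simp add: m_def pos)
  have K: "K > 0" by (simp add: K_def)
  have "pos_semidef (\<rho> + t *\<^sub>R \<Delta>)" if t: "\<bar>t\<bar> \<le> m / K" for t
  proof -
    have "0 \<le> Re (qform (\<rho> + t *\<^sub>R \<Delta>) v)" for v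
    proof (cases "v = 0")
      case False
      define w where "w = (1 / norm v) *\<^sub>R v"
      have w: "w \<in> ?S" "v = norm v *\<^sub>R w" using False by (simp_all add: w_def)
      have "\<bar>t * Re (qform \<Delta> w)\<bar> \<le> (m / K) * K"
        unfolding abs_mult using t v1[OF w(1)] m K by (intro mult_mono) (auto simp: K_def)
      then have "- m \<le> t * Re (qform \<Delta> w)" using K by simp
      moreover have "m \<le> Re (qform \<rho> w)" using v0(2)[OF w(1)] by (simp add: m_def)
      ultimately have "0 \<le> Re (qform (\<rho> + t *\<^sub>R \<Delta>) w)"
        by (simp add: qform_add qform_scaleR)
      then show ?thesis by (subst w(2)) (simp add: qform_scaleR_arg)
    qed (simp add: qform_sum)
    moreover have "hermitian (\<rho> + t *\<^sub>R \<Delta>)"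
      by (intro hermitian_add hermitian_scaleR h)
    ultimately show ?thesis by (simp add: pos_semidef_iff)
  qed
  then show ?thesis using m K by (intro exI[of _ "m / K"]) auto
qed

text \<open>The witness is zero at \<rho>, so on the line through \<rho> along \<Delta> it is linear
  in \<open>t\<close>, and a nonzero slope yields a negative value at a state that \<open>E\<close>
  cannot tell from \<rho>.\<close>

lemma witness_annihilator_zero:
  fixes E :: "'j \<Rightarrow> complex^('d::finite \<times> 'd)^('d \<times> 'd)"
  assumes d: "CARD('d) \<ge> 2" and det: "determines_separability J E"
    and h: "hermitian \<Delta>" and tr: "trace \<Delta> = 0" and ann: "\<And>j. j \<in> J \<Longrightarrow> trace (\<Delta> ** E j) = 0"
    and AC: "A ** C = mat 1" "C ** A = mat 1"
  shows "witness A A \<Delta> = 0"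
proof (rule ccontr)
  assume nz: "witness A A \<Delta> \<noteq> 0"
  have "Im (witness A A \<Delta>) = 0"
    using witness_cnj[OF h, of A A] by (simp add: complex_eq_iff)
  then have re: "Re (witness A A \<Delta>) \<noteq> 0" using nz by (simp add: complex_eq_iff)
  obtain \<rho> where \<rho>: "separable \<rho>" "\<And>v. v \<noteq> 0 \<Longrightarrow> 0 < Re (qform \<rho> v)" "witness A A \<rho> = 0"
    using full_rank_separable_witness_zero[OF d AC] by blast
  have st: "state \<rho>" using \<rho>(1) by (simp add: separable_def)
  then have "hermitian \<rho>" by (simp add: state_def pos_semidef_iff)
  then obtain \<delta> where \<delta>: "\<delta> > 0" "\<And>t. \<bar>t\<bar> \<le> \<delta> \<Longrightarrow> pos_semidef (\<rho> + t *\<^sub>R \<Delta>)"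
    using pos_def_perturbation[OF _ h \<rho>(2)] by blast
  \<comment> \<open>This sign makes the witness value at the perturbed state -\<delta> times the
    modulus of the slope.\<close>
  define t where "t = - \<delta> * sgn (Re (witness A A \<Delta>))"
  have "\<bar>t\<bar> \<le> \<delta>" using \<delta>(1) by (simp add: t_def abs_mult sgn_if)
  then have "state (\<rho> + t *\<^sub>R \<Delta>)"
    using \<delta>(2) st by (simp add: state_def trace_add trace_scaleR tr)
  moreover have "Re (witness A A (\<rho> + t *\<^sub>R \<Delta>)) < 0"
  proof -
    have "Re (witness A A (\<rho> + t *\<^sub>R \<Delta>)) = - \<delta> * \<bar>Re (witness A A \<Delta>)\<bar>"
      by (simp add: witness_add witness_scaleR \<rho>(3)) (simp add: t_def abs_sgn mult_ac)
    then show ?thesis using \<delta>(1) re by simp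
  qed
  then have "\<not> separable (\<rho> + t *\<^sub>R \<Delta>)"
    using witness_separable_nonneg[of "\<rho> + t *\<^sub>R \<Delta>" A] by linarith
  ultimately have ent: "entangled (\<rho> + t *\<^sub>R \<Delta>)" by (simp add: entangled_def)
  have "trace (\<rho> ** E j) = trace ((\<rho> + t *\<^sub>R \<Delta>) ** E j)" if "j \<in> J" for j
  proof -
    have "(t *\<^sub>R \<Delta>) ** E j = t *\<^sub>R (\<Delta> ** E j)"
      by (simp add: matrix_matrix_mult_def vec_eq_iff scaleR_sum_right)
    moreover have "(\<rho> + t *\<^sub>R \<Delta>) ** E j = \<rho> ** E j + (t *\<^sub>R \<Delta>) ** E j"
      by (simp add: matrix_matrix_mult_def vec_eq_iff distrib_right sum.distrib)
    ultimately show ?thesis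
      using ann[OF that] by (simp add: trace_add trace_scaleR)
  qed
  with \<rho>(1) ent det show False unfolding determines_separability_def by blast
qed

section \<open>From invertible matrices to all matrices\<close>

text \<open>A kernel vector satisfies v = - t B v; for small \<open>t\<close> the right side has
  norm at most half that of \<open>v\<close>, so the kernel is trivial.\<close>

lemma invertible_perturbed_identity:
  fixes B :: "complex^'n^'n"
  shows "\<exists>\<delta>>0. \<forall>t. \<bar>t\<bar> \<le> \<delta> \<longrightarrow> (\<exists>C. (mat 1 + t *\<^sub>R B) ** C = mat 1 \<and> C ** (mat 1 + t *\<^sub>R B) = mat 1)"
proof -
  have scal: "(t *\<^sub>R M) *v v = t *\<^sub>R (M *v v)" "M *v (t *\<^sub>R v) = t *\<^sub>R (M *v v)"
    for t and M :: "complex^'n^'n" and v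
    by (simp_all add: matrix_vector_mult_def vec_eq_iff scaleR_sum_right)
  have "linear ((*v) B)"
    by (intro linearI) (simp_all add: matrix_vector_right_distrib scal)
  then have "bounded_linear ((*v) B)" by (simp add: linear_conv_bounded_linear)
  then obtain K where K: "K > 0" "\<And>v. norm (B *v v) \<le> norm v * K"
    using bounded_linear.pos_bounded by blast
  define \<delta> where "\<delta> = 1 / (2 * K)"
  have "\<exists>C. (mat 1 + t *\<^sub>R B) ** C = mat 1 \<and> C ** (mat 1 + t *\<^sub>R B) = mat 1"
    if t: "\<bar>t\<bar> \<le> \<delta>" for t
  proof -
    have "v = 0" if "(mat 1 + t *\<^sub>R B) *v v = 0" for v
    proof -
      have "v = - (t *\<^sub>R (B *v v))"
        using that by (simp add: matrix_vector_mult_add_rdistrib scal eq_neg_iff_add_eq_0)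
      then have "norm v = norm (- (t *\<^sub>R (B *v v)))" by (rule arg_cong)
      then have "norm v = \<bar>t\<bar> * norm (B *v v)" by simp
      also have "\<dots> \<le> \<delta> * (norm v * K)"
        using t K by (intro mult_mono) auto
      also have "\<dots> = norm v / 2" using K(1) by (simp add: \<delta>_def)
      finally show "v = 0" by simp
    qed
    then have "\<exists>C. C ** (mat 1 + t *\<^sub>R B) = mat 1"
      by (simp add: matrix_left_invertible_ker)
    then show ?thesis using matrix_left_right_inverse by blast
  qed
  moreover have "\<delta> > 0" using K(1) by (simp add: \<delta>_def)
  ultimately show ?thesis by blast
qed

text \<open>Matrix units read off every entry of \<open>X\<close>, so the sesquilinear form
  determines \<open>X\<close>.\<close>

lemma witness_matrix_unit:
  fixes X :: "complex^('d::finite \<times> 'd)^('d \<times> 'd)"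
  shows "witness (\<chi> a b. if a = i \<and> b = p then 1 else 0) (\<chi> a b. if a = j \<and> b = q then 1 else 0) X
    = X $ (p, j) $ (q, i)"
proof -
  have "witness (\<chi> a b. if a = i \<and> b = p then 1 else 0) (\<chi> a b. if a = j \<and> b = q then 1 else 0) X
    = (\<Sum>a\<in>UNIV. \<Sum>b\<in>UNIV. \<Sum>c\<in>UNIV. \<Sum>e\<in>UNIV. if e = q then if c = j then if b = p then if a = i
        then X $ (p, j) $ (q, i) else 0 else 0 else 0 else 0)"
    unfolding witness_def by (intro sum.cong refl) auto
  then show ?thesis by simp
qed

lemma zero_if_witness_zero_on_invertible:
  assumes 0: "\<And>A C. A ** C = mat 1 \<Longrightarrow> C ** A = mat 1 \<Longrightarrow> witness A A X = 0"
  shows "X = 0"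
proof -
  have diag: "witness B B X = 0" for B
  proof -
    obtain \<delta> where \<delta>: "\<delta> > 0"
      "\<And>t. \<bar>t\<bar> \<le> \<delta> \<Longrightarrow> \<exists>C. (mat 1 + t *\<^sub>R B) ** C = mat 1 \<and> C ** (mat 1 + t *\<^sub>R B) = mat 1"
      using invertible_perturbed_identity[of B] by blast
    define I :: "complex^'a^'a" where "I = mat 1"
    have sc: "t *\<^sub>R B = (\<chi> i j. of_real t * B $ i $ j)" for t
      by (simp add: vec_eq_iff) (simp add: scaleR_conv_of_real)
    \<comment> \<open>A quadratic polynomial in \<open>t\<close> that vanishes near 0; its leading
      coefficient is the wanted value.\<close>
    have eq: "witness I I X + of_real t * (witness I B X + witness B I X) + (of_real t)\<^sup>2 * witness B B X = 0"
      if "\<bar>t\<bar> \<le> \<delta>" for t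
    proof -
      have "witness (I + t *\<^sub>R B) (I + t *\<^sub>R B) X = 0"
        using \<delta>(2)[OF that] 0 unfolding I_def by blast
      then show ?thesis
        unfolding sc
        by (simp add: witness_add_left witness_add_right witness_scale_left witness_scale_right
            power2_eq_square algebra_simps)
    qed
    have "witness I I X = 0" using eq[of 0] \<delta>(1) by simp
    then have pm: "of_real \<delta> * (witness I B X + witness B I X) + (of_real \<delta>)\<^sup>2 * witness B B X = 0"
      "- of_real \<delta> * (witness I B X + witness B I X) + (of_real \<delta>)\<^sup>2 * witness B B X = 0"
      using eq[of \<delta>] eq[of "- \<delta>"] \<delta>(1) by simp_all
    \<comment> \<open>Adding the equations for \<delta> and -\<delta> cancels the linear
      term.\<close>
    have "2 * (of_real \<delta>)\<^sup>2 * witness B B X = 0"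
      using arg_cong2[OF pm, of "(+)"] by auto
    then show ?thesis using \<delta>(1) by simp
  qed
  have "witness B C X = 0" for B C
  proof -
    \<comment> \<open>Polarisation: \<omega> = 1 makes the two mixed terms opposite, the imaginary
      unit makes them equal, so both vanish.\<close>
    have *: "cnj \<omega> * witness B C X + \<omega> * witness C B X = 0" for \<omega>
      using diag[of "B + (\<chi> i j. \<omega> * C $ i $ j)"]
      unfolding witness_add_left witness_add_right witness_scale_left witness_scale_right
      by (simp add: diag add.commute)
    have "witness C B X = - witness B C X"
      using *[of 1] by (simp add: eq_neg_iff_add_eq_0 add.commute)
    then show ?thesis using *[of \<i>] by simp
  qed
  then have "X $ (p, j) $ (q, i) = 0" for p j q i
    unfolding witness_matrix_unit[of i p j q X, symmetric] .
  then show ?thesis by (simp add: vec_eq_iff)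
qed

theorem corollary2:
  fixes J :: "'j set"
    and E :: "'j \<Rightarrow> complex^('d::finite \<times> 'd)^('d \<times> 'd)"
  assumes "CARD('d) \<ge> 2"
    and "povm J E"
    and "determines_separability J E"
  shows "informationally_complete J E"
proof -
  have "\<Delta> = 0" if \<Delta>: "hermitian \<Delta>" "\<And>j. j \<in> J \<Longrightarrow> trace (\<Delta> ** E j) = 0" for \<Delta>
  proof -
    \<comment> \<open>Distributing \<Delta> over the resolution of the identity shows that \<Delta>
      is traceless, so perturbations along it keep trace one.\<close>
    have "\<Delta> ** (\<Sum>j\<in>K. E j) = (\<Sum>j\<in>K. \<Delta> ** E j)" for K
      by (induction K rule: infinite_finite_induct)
        (simp_all add: matrix_add_ldistrib)
    from this[of J] have "\<Delta> = (\<Sum>j\<in>J. \<Delta> ** E j)"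
      using assms(2) by (simp add: povm_def)
    then have "trace \<Delta> = (\<Sum>j\<in>J. trace (\<Delta> ** E j))"
      by (metis trace_matrix_sum)
    then have "trace \<Delta> = 0" by (simp add: \<Delta>(2))
    then show "\<Delta> = 0"
      using witness_annihilator_zero[OF assms(1,3) \<Delta>(1)] \<Delta>(2)
      by (intro zero_if_witness_zero_on_invertible) blast
  qed
  then have "povm_annihilator J E = {0}"
    by (auto simp: povm_annihilator_def hermitian_zero trace_def)
  then show ?thesis by (simp add: informationally_complete_def)
qed

end
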